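(* A group $G$ admits a homogeneous length function if and only if $G$ is abelian and torsion-free.
   Context: Let $G$ be a group, written multiplicatively, with identity $e$. A length function on $G$ is a map $\ell: G \to [0,+\infty)$ such that $\ell(e)=0$, $\ell(x^{-1})=\ell(x)$ and $\ell(xy)\le \ell(x)+\ell(y)$ for all $x,y\in G$, and $\ell(x)>0$ for all $x \in G\setminus\{e\}$. It is homogeneous if $\ell(x^n)=|n|\,\ell(x)$ for all $x\in G$ and all $n\in\mathbb{Z}$. *)

theory Defs
  imports Complex_Main "HOL-Algebra.Group"
begin

text \<open>
  The axioms constrain \<open>l\<close> only on \<open>carrier G\<close>; its values elsewhere are irrelevant.
\<close>

definition length_function :: "('a, 'b) monoid_scheme \<Rightarrow> ('a \<Rightarrow> real) \<Rightarrow> bool" where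
  "length_function G l \<longleftrightarrow>
     l \<in> carrier G \<rightarrow> {0..} \<and>
     l \<one>\<^bsub>G\<^esub> = 0 \<and>
     (\<forall>x\<in>carrier G. l (inv\<^bsub>G\<^esub> x) = l x) \<and>
     (\<forall>x\<in>carrier G. \<forall>y\<in>carrier G. l (x \<otimes>\<^bsub>G\<^esub> y) \<le> l x + l y) \<and>
     (\<forall>x\<in>carrier G - {\<one>\<^bsub>G\<^esub>}. l x > 0)"

definition homogeneous_length_function :: "('a, 'b) monoid_scheme \<Rightarrow> ('a \<Rightarrow> real) \<Rightarrow> bool" where
  "homogeneous_length_function G l \<longleftrightarrow>
     length_function G l \<and>
     (\<forall>x\<in>carrier G. \<forall>n::int. l (x [^]\<^bsub>G\<^esub> n) = real_of_int \<bar>n\<bar> * l x)"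

definition torsion_free :: "('a, 'b) monoid_scheme \<Rightarrow> bool" where
  "torsion_free G \<longleftrightarrow>
     (\<forall>x\<in>carrier G. \<forall>n::nat. n > 0 \<longrightarrow> x [^]\<^bsub>G\<^esub> n = \<one>\<^bsub>G\<^esub> \<longrightarrow> x = \<one>\<^bsub>G\<^esub>)"

end

theory Submission
  imports Defs "HOL-Algebra.FiniteProduct"
begin

text \<open>
  A homogeneous length function \<open>l\<close> vanishes on commutators.  Homogeneity makes \<open>l\<close> conjugation
  invariant (\<open>homogeneous_conj\<close>), and applied to high powers of an element that can be written both
  as \<open>w y\<close> and as a conjugate of \<open>z w\<^sup>-\<^sup>1\<close> it bounds the length of that element by the mean of \<open>l y\<close>
  and \<open>l z\<close> (\<open>homogeneous_split\<close>).  With \<open>c\<close> the commutator of \<open>x\<close> and \<open>y\<close>, this says that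
  \<open>f (m, k) = l (x\<^sup>m c\<^sup>k)\<close> is at most the mean of \<open>f (m - 1, k)\<close> and \<open>f (m + 1, k - 1)\<close>.  Along these
  two moves the quantity \<open>t = m + 2 k\<close> drops by one and \<open>m\<close> performs a simple random walk, which
  after \<open>2 n\<close> steps from \<open>(0, n)\<close> is at distance of order \<open>\<surd>n\<close>; hence \<open>n l c = f (0, n)\<close> grows
  at most like \<open>\<surd>n\<close>, and \<open>l c = 0\<close>.  The random walk enters only through the fact that \<open>m\<^sup>2 + t\<close>
  equals its mean over the two moves, so that a multiple of \<open>K\<^sup>2 + m\<^sup>2 + t\<close> dominates \<open>f\<close>
  (\<open>commutator_walk_bound\<close>).  Torsion-freeness is immediate from homogeneity and positivity.

  Conversely, a torsion-free abelian group has a maximal independent subset \<open>B\<close>, and every element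
  has a nonzero power that is a product of powers of elements of \<open>B\<close>.  The sum of the absolute
  values of the exponents, divided by the absolute value of the power taken, is the
  \<open>\<ell>\<^sup>1\<close> norm with respect to the basis \<open>B\<close> of the rational vector space spanned by the group;
  torsion-freeness makes it positive off the identity.
\<close>

section \<open>Homogeneous length functions vanish on commutators\<close>

lemma le_of_nat_mult_le_add:
  fixes a b c :: real
  assumes "\<And>n::nat. real n * a \<le> real n * b + c"
  shows "a \<le> b"
proof (rule ccontr)
  assume "\<not> a \<le> b"
  then have "a - b > 0" by simp
  then obtain n :: nat where "c < real n * (a - b)"
    using reals_Archimedean3 by blast
  with assms[of n] show False by (simp add: algebra_simps)
qed

context group
begin

lemma conj_nat_pow:
  assumes "x \<in> carrier G" "y \<in> carrier G"
  shows "(y \<otimes> x \<otimes> inv y) [^] (n::nat) = y \<otimes> x [^] n \<otimes> inv y"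
proof (induction n)
  case 0
  then show ?case using assms by simp
next
  case (Suc n)
  have "inv y \<otimes> (y \<otimes> (x \<otimes> inv y)) = x \<otimes> inv y"
    using assms by (simp add: m_assoc[symmetric])
  with Suc show ?case using assms by (simp add: m_assoc)
qed

context
  fixes l :: "'a \<Rightarrow> real"
  assumes hom: "homogeneous_length_function G l"
begin

lemma length_nonneg: "x \<in> carrier G \<Longrightarrow> 0 \<le> l x"
  and length_inv: "x \<in> carrier G \<Longrightarrow> l (inv x) = l x"
  and length_mult: "x \<in> carrier G \<Longrightarrow> y \<in> carrier G \<Longrightarrow> l (x \<otimes> y) \<le> l x + l y"
  and length_pos: "x \<in> carrier G \<Longrightarrow> x \<noteq> \<one> \<Longrightarrow> 0 < l x"
  and length_int_pow: "x \<in> carrier G \<Longrightarrow> l (x [^] (k::int)) = real_of_int \<bar>k\<bar> * l x"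
  using hom unfolding homogeneous_length_function_def length_function_def by auto

lemma length_one: "l \<one> = 0"
  using hom unfolding homogeneous_length_function_def length_function_def by auto

lemma length_nat_pow: "x \<in> carrier G \<Longrightarrow> l (x [^] (n::nat)) = real n * l x"
  using length_int_pow[of x "int n"] by (simp add: int_pow_int)

lemma length_mult3:
  assumes "x \<in> carrier G" "y \<in> carrier G" "z \<in> carrier G"
  shows "l (x \<otimes> y \<otimes> z) \<le> l x + l y + l z"
  using length_mult[of "x \<otimes> y" z] length_mult[of x y] assms by simp

lemma homogeneous_conj_le:
  assumes "x \<in> carrier G" "y \<in> carrier G"
  shows "l (y \<otimes> x \<otimes> inv y) \<le> l x"
proof (rule le_of_nat_mult_le_add)
  fix n :: nat
  have "real n * l (y \<otimes> x \<otimes> inv y) = l (y \<otimes> x [^] n \<otimes> inv y)"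
    using assms by (simp add: length_nat_pow[symmetric] conj_nat_pow)
  also have "\<dots> \<le> l y + l (x [^] n) + l (inv y)"
    using assms by (intro length_mult3) auto
  finally show "real n * l (y \<otimes> x \<otimes> inv y) \<le> real n * l x + 2 * l y"
    using assms by (simp add: length_nat_pow length_inv)
qed

lemma homogeneous_conj:
  assumes "x \<in> carrier G" "y \<in> carrier G"
  shows "l (y \<otimes> x \<otimes> inv y) = l x"
proof (rule antisym[OF homogeneous_conj_le[OF assms]])
  have "inv y \<otimes> (y \<otimes> x \<otimes> inv y) \<otimes> inv (inv y) = x"
    using assms by (simp add: m_assoc) (simp add: m_assoc[symmetric])
  then show "l x \<le> l (y \<otimes> x \<otimes> inv y)"
    using homogeneous_conj_le[of "y \<otimes> x \<otimes> inv y" "inv y"] assms by simp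
qed

lemma homogeneous_split:
  assumes carr: "w \<in> carrier G" "y \<in> carrier G" "z \<in> carrier G" "t \<in> carrier G"
    and eq: "w \<otimes> y = t \<otimes> (z \<otimes> inv w) \<otimes> inv t"
  shows "l (w \<otimes> y) \<le> (l y + l z) / 2"
proof -
  define A where "A n = (w \<otimes> y) [^] n \<otimes> t \<otimes> (z \<otimes> inv w) [^] n" for n :: nat
  have A_carr: "A n \<in> carrier G" for n
    unfolding A_def using carr by simp
  have A_le: "l (A n) \<le> real n * (l y + l z) + l t" for n
  proof (induction n)
    case 0
    then show ?case using carr by (simp add: A_def)
  next
    case (Suc n)
    \<comment> \<open>The outermost \<open>w\<close> and \<open>w\<^sup>-\<^sup>1\<close> form a conjugation, which does not affect the length.\<close>
    have "A (Suc n) = (w \<otimes> y) \<otimes> A n \<otimes> (z \<otimes> inv w)"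
      unfolding A_def nat_pow_Suc2[OF m_closed[OF carr(1,2)]]
      using carr by (simp add: m_assoc)
    also have "\<dots> = w \<otimes> (y \<otimes> A n \<otimes> z) \<otimes> inv w"
      using carr A_carr by (simp add: m_assoc)
    finally have "l (A (Suc n)) = l (y \<otimes> A n \<otimes> z)"
      using carr A_carr by (simp add: homogeneous_conj)
    also have "\<dots> \<le> l y + l (A n) + l z"
      using carr A_carr by (intro length_mult3)
    finally show ?case using Suc by (simp add: algebra_simps)
  qed
  have "2 * l (w \<otimes> y) \<le> l y + l z"
  proof (rule le_of_nat_mult_le_add)
    fix n :: nat
    have "(w \<otimes> y) [^] n \<otimes> (w \<otimes> y) [^] n
        = (w \<otimes> y) [^] n \<otimes> (t \<otimes> (z \<otimes> inv w) [^] n \<otimes> inv t)"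
      using carr by (metis conj_nat_pow eq inv_closed m_closed)
    also have "\<dots> = A n \<otimes> inv t"
      unfolding A_def using carr by (simp add: m_assoc)
    finally have "(w \<otimes> y) [^] (n + n) = A n \<otimes> inv t"
      using carr by (simp add: nat_pow_mult)
    then have "real (n + n) * l (w \<otimes> y) = l (A n \<otimes> inv t)"
      using carr length_nat_pow by (metis m_closed)
    also have "\<dots> \<le> l (A n) + l t"
      using length_mult[of "A n" "inv t"] carr A_carr by (simp add: length_inv)
    finally show "real n * (2 * l (w \<otimes> y)) \<le> real n * (l y + l z) + 2 * l t"
      using A_le[of n] by (simp add: algebra_simps)
  qed
  then show ?thesis by simp
qed

lemma commutator_walk_step:
  fixes m k :: int
  assumes carr: "x \<in> carrier G" "y \<in> carrier G"
    and c: "c = x \<otimes> y \<otimes> inv x \<otimes> inv y"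
  shows "l (x [^] m \<otimes> c [^] k)
    \<le> (l (x [^] (m - 1) \<otimes> c [^] k) + l (x [^] (m + 1) \<otimes> c [^] (k - 1))) / 2"
proof -
  have cc: "c \<in> carrier G" using carr c by simp
  define v where "v = x [^] m \<otimes> c [^] (k - 1)"
  define z where "z = inv y \<otimes> (v \<otimes> x) \<otimes> inv (inv y)"
  have vc: "v \<in> carrier G" unfolding v_def using carr cc by simp
  have zc: "z \<in> carrier G" unfolding z_def using carr vc by simp
  have 1: "x \<otimes> (x [^] (m - 1) \<otimes> c [^] k) = x [^] m \<otimes> c [^] k"
    using carr cc int_pow_mult[of x 1 "m - 1"] by (simp add: m_assoc[symmetric] int_pow_1)
  have "y \<otimes> (inv y \<otimes> u) = (y \<otimes> inv y) \<otimes> u" if "u \<in> carrier G" for u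
    using carr that by (simp only: m_assoc inv_closed)
  then have "y \<otimes> (z \<otimes> inv x) \<otimes> inv y = (y \<otimes> inv y) \<otimes> v \<otimes> (x \<otimes> y \<otimes> inv x \<otimes> inv y)"
    unfolding z_def using carr vc by (simp add: m_assoc)
  also have "\<dots> = v \<otimes> c" using carr vc c by simp
  also have "\<dots> = x [^] m \<otimes> c [^] k"
    unfolding v_def using carr cc int_pow_mult[of c "k - 1" 1]
    by (simp add: m_assoc int_pow_1)
  finally have 2: "x [^] m \<otimes> c [^] k = y \<otimes> (z \<otimes> inv x) \<otimes> inv y" by simp
  have "x [^] (m + 1) \<otimes> c [^] (k - 1) = x \<otimes> v"
    unfolding v_def using carr cc int_pow_mult[of x 1 m]
    by (simp add: m_assoc[symmetric] int_pow_1 add.commute)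
  also have "\<dots> = x \<otimes> (v \<otimes> x) \<otimes> inv x"
    using carr vc by (simp add: m_assoc)
  finally have 3: "l z = l (x [^] (m + 1) \<otimes> c [^] (k - 1))"
    unfolding z_def using carr vc homogeneous_conj[of "v \<otimes> x" "inv y"]
      homogeneous_conj[of "v \<otimes> x" x] by simp
  show ?thesis
    using homogeneous_split[of x "x [^] (m - 1) \<otimes> c [^] k" z y] 1 2 3 carr cc zc by simp
qed

text \<open>
  The function \<open>m\<^sup>2 + t\<close> of the position \<open>m\<close> and the remaining number \<open>t\<close> of steps equals its mean
  over the two steps.  At \<open>t = 0\<close> the bound is the triangle inequality together with
  \<open>2 K \<bar>m\<bar> \<le> K\<^sup>2 + m\<^sup>2\<close>; the parameter \<open>K\<close> is the slack that replaces a square root.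
\<close>

lemma commutator_walk_bound:
  fixes m k :: int and t :: nat and K :: real
  assumes carr: "x \<in> carrier G" "y \<in> carrier G"
    and c: "c = x \<otimes> y \<otimes> inv x \<otimes> inv y"
    and K: "K > 0"
    and t: "m + 2 * k = int t"
  shows "2 * K * l (x [^] m \<otimes> c [^] k) \<le> (l x + l c) * (K\<^sup>2 + (real_of_int m)\<^sup>2 + real t)"
  using t
proof (induction t arbitrary: m k)
  case 0
  have cc: "c \<in> carrier G" using carr c by simp
  have C: "0 \<le> l x + l c" using length_nonneg carr cc by simp
  have "\<bar>k\<bar> \<le> \<bar>m\<bar>" using 0 by linarith
  then have km: "real_of_int \<bar>k\<bar> \<le> real_of_int \<bar>m\<bar>" by (simp only: of_int_le_iff)
  have "l (x [^] m \<otimes> c [^] k) \<le> real_of_int \<bar>m\<bar> * l x + real_of_int \<bar>k\<bar> * l c"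
    using length_mult[of "x [^] m" "c [^] k"] carr cc by (simp add: length_int_pow)
  also have "\<dots> \<le> real_of_int \<bar>m\<bar> * (l x + l c)"
    using mult_right_mono[OF km length_nonneg[OF cc]] by (simp add: algebra_simps)
  finally have "2 * K * l (x [^] m \<otimes> c [^] k) \<le> 2 * K * (real_of_int \<bar>m\<bar> * (l x + l c))"
    using K by (intro mult_left_mono) auto
  also have "\<dots> = (l x + l c) * (2 * K * \<bar>real_of_int m\<bar>)" by simp
  also have "2 * K * \<bar>real_of_int m\<bar> \<le> K\<^sup>2 + (real_of_int m)\<^sup>2"
    using sum_squares_bound[of K "\<bar>real_of_int m\<bar>"] by simp
  finally show ?case using C by (simp add: mult_left_mono)
next
  case (Suc t)
  have "2 * K * l (x [^] m \<otimes> c [^] k)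
      \<le> 2 * K * ((l (x [^] (m - 1) \<otimes> c [^] k) + l (x [^] (m + 1) \<otimes> c [^] (k - 1))) / 2)"
    using commutator_walk_step[OF carr c] K by (intro mult_left_mono) auto
  also have "\<dots> = (2 * K * l (x [^] (m - 1) \<otimes> c [^] k)
      + 2 * K * l (x [^] (m + 1) \<otimes> c [^] (k - 1))) / 2"
    by (simp add: algebra_simps)
  also have "\<dots> \<le> ((l x + l c) * (K\<^sup>2 + (real_of_int (m - 1))\<^sup>2 + real t)
      + (l x + l c) * (K\<^sup>2 + (real_of_int (m + 1))\<^sup>2 + real t)) / 2"
    using Suc.IH[of "m - 1" k] Suc.IH[of "m + 1" "k - 1"] Suc.prems by simp
  also have "\<dots> = (l x + l c) * (K\<^sup>2 + (real_of_int m)\<^sup>2 + real (Suc t))"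
    by (simp add: field_simps power2_eq_square)
  finally show ?case .
qed

lemma homogeneous_commutator_eq_zero:
  assumes carr: "x \<in> carrier G" "y \<in> carrier G"
  shows "l (x \<otimes> y \<otimes> inv x \<otimes> inv y) = 0"
proof -
  define c where "c = x \<otimes> y \<otimes> inv x \<otimes> inv y"
  have cc: "c \<in> carrier G" using carr c_def by simp
  define C where "C = l x + l c"
  have bound: "K * l c \<le> C" if K: "K > 0" for K :: real
  proof (rule le_of_nat_mult_le_add)
    fix n :: nat
    have "2 * K * (real n * l c) \<le> C * (K\<^sup>2 + real (2 * n))"
      using commutator_walk_bound[OF carr c_def K, of 0 "int n" "2 * n"] cc
      by (simp add: C_def length_nat_pow int_pow_int)
    then show "real n * (K * l c) \<le> real n * C + C * K\<^sup>2 / 2"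
      by (simp add: algebra_simps)
  qed
  have "l c \<le> 0"
  proof (rule le_of_nat_mult_le_add)
    fix n :: nat
    have "real n * l c \<le> real (Suc n) * l c"
      using length_nonneg[OF cc] by (intro mult_right_mono) auto
    with bound[of "real (Suc n)"] show "real n * l c \<le> real n * 0 + C" by simp
  qed
  with length_nonneg[OF cc] show ?thesis unfolding c_def by simp
qed

lemma homogeneous_imp_comm_group: "comm_group G"
proof (rule group_comm_groupI)
  fix x y assume carr: "x \<in> carrier G" "y \<in> carrier G"
  have "x \<otimes> y \<otimes> inv x \<otimes> inv y = \<one>"
    using homogeneous_commutator_eq_zero[OF carr] length_pos[of "x \<otimes> y \<otimes> inv x \<otimes> inv y"] carr
    by fastforce
  then have "x \<otimes> y \<otimes> inv (y \<otimes> x) = \<one>"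
    using carr by (simp add: inv_mult_group m_assoc)
  then show "x \<otimes> y = y \<otimes> x"
    using carr by (metis inv_closed inv_equality inv_inv m_closed)
qed

lemma homogeneous_imp_torsion_free: "torsion_free G"
  unfolding torsion_free_def
proof (intro ballI allI impI)
  fix x and n :: nat
  assume x: "x \<in> carrier G" and n: "n > 0" and "x [^] n = \<one>"
  then have "real n * l x = 0" using length_nat_pow[of x n] length_one by simp
  then show "x = \<one>" using n length_pos[OF x] by auto
qed

end

end

section \<open>Integer combinations in an abelian group\<close>

context comm_group
begin

text \<open>
  The combination with exponents \<open>a\<close> over a set \<open>F\<close> (meaningful for finite \<open>F\<close>), written
  multiplicatively.
\<close>

definition int_comb :: "'a set \<Rightarrow> ('a \<Rightarrow> int) \<Rightarrow> 'a" where
  "int_comb F a = finprod G (\<lambda>b. b [^] a b) F"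

text \<open>Independence over the integers.\<close>

definition int_indep :: "'a set \<Rightarrow> bool" where
  "int_indep B \<longleftrightarrow> B \<subseteq> carrier G \<and>
     (\<forall>F a. finite F \<longrightarrow> F \<subseteq> B \<longrightarrow> int_comb F a = \<one> \<longrightarrow> (\<forall>b\<in>F. a b = 0))"

text \<open>
  \<open>int_rep B x n F a\<close>: the nonzero power \<open>x\<^sup>n\<close> is the combination with exponents \<open>a\<close>, supported in
  the finite set \<open>F \<subseteq> B\<close>.  In additive notation \<open>x\<close> has coordinates \<open>a b / n\<close> with respect to \<open>B\<close>.
\<close>

definition int_rep :: "'a set \<Rightarrow> 'a \<Rightarrow> int \<Rightarrow> 'a set \<Rightarrow> ('a \<Rightarrow> int) \<Rightarrow> bool" where
  "int_rep B x n F a \<longleftrightarrow> n \<noteq> 0 \<and> finite F \<and> F \<subseteq> B \<and> (\<forall>b. b \<notin> F \<longrightarrow> a b = 0)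
     \<and> x [^] n = int_comb F a"

lemma int_comb_closed: "F \<subseteq> carrier G \<Longrightarrow> int_comb F a \<in> carrier G"
  unfolding int_comb_def by (intro finprod_closed) auto

lemma int_comb_zero: "F \<subseteq> carrier G \<Longrightarrow> (\<And>b. b \<in> F \<Longrightarrow> a b = 0) \<Longrightarrow> int_comb F a = \<one>"
  unfolding int_comb_def by (intro finprod_one_eqI) auto

lemma int_comb_add:
  assumes "F \<subseteq> carrier G"
  shows "int_comb F (\<lambda>b. a b + a' b) = int_comb F a \<otimes> int_comb F a'"
proof -
  have "int_comb F (\<lambda>b. a b + a' b) = finprod G (\<lambda>b. b [^] a b \<otimes> b [^] a' b) F"
    unfolding int_comb_def using assms by (intro finprod_cong') (auto simp: int_pow_mult)
  also have "\<dots> = int_comb F a \<otimes> int_comb F a'"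
    unfolding int_comb_def using assms by (intro finprod_multf) auto
  finally show ?thesis .
qed

lemma int_comb_mult:
  assumes "finite F" "F \<subseteq> carrier G"
  shows "int_comb F (\<lambda>b. a b * k) = int_comb F a [^] (k::int)"
  using assms
proof (induction F rule: finite_induct)
  case empty
  then show ?case by (simp add: int_comb_def)
next
  case (insert x F)
  have "finprod G (\<lambda>b. b [^] a b) F \<in> carrier G"
    using insert by (intro finprod_closed) auto
  moreover have "(\<lambda>b. b [^] a b) \<in> F \<rightarrow> carrier G" "(\<lambda>b. b [^] (a b * k)) \<in> F \<rightarrow> carrier G"
    using insert by auto
  ultimately show ?case
    using insert by (simp add: int_comb_def int_pow_distrib int_pow_pow)
qed

lemma int_comb_superset:
  assumes "finite F'" "F \<subseteq> F'" "F' \<subseteq> carrier G" "\<And>b. b \<notin> F \<Longrightarrow> a b = 0"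
  shows "int_comb F' a = int_comb F a"
  unfolding int_comb_def
  using assms by (intro finprod_mono_neutral_cong_left[symmetric]) auto

section \<open>Maximal independent sets and the length they define\<close>

lemma exists_maximal_int_indep:
  "\<exists>B. int_indep B \<and> (\<forall>X. int_indep X \<longrightarrow> B \<subseteq> X \<longrightarrow> X = B)"
proof -
  have "\<exists>M\<in>{B. int_indep B}. \<forall>X\<in>{B. int_indep B}. M \<subseteq> X \<longrightarrow> X = M"
  proof (rule subset_Zorn_nonempty)
    have "int_indep {}" by (simp add: int_indep_def)
    then show "{B. int_indep B} \<noteq> {}" by blast
  next
    fix \<C> assume ne: "\<C> \<noteq> {}" and ch: "subset.chain {B. int_indep B} \<C>"
    then have indep: "\<And>B. B \<in> \<C> \<Longrightarrow> int_indep B"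
      by (auto simp: subset.chain_def)
    have "\<forall>b\<in>F. a b = 0" if F: "finite F" "F \<subseteq> \<Union>\<C>" and one: "int_comb F a = \<one>" for F a
    proof -
      obtain B where "B \<in> \<C>" "F \<subseteq> B"
        using finite_subset_Union_chain[OF F ne ch] by blast
      then show ?thesis using indep[of B] F one unfolding int_indep_def by blast
    qed
    moreover have "\<Union>\<C> \<subseteq> carrier G" using indep unfolding int_indep_def by blast
    ultimately show "\<Union>\<C> \<in> {B. int_indep B}" unfolding int_indep_def by blast
  qed
  then show ?thesis by blast
qed

lemma maximal_int_indep_rep:
  assumes B: "int_indep B" and max: "\<And>X. int_indep X \<Longrightarrow> B \<subseteq> X \<Longrightarrow> X = B"
    and x: "x \<in> carrier G"
  shows "\<exists>n F a. int_rep B x n F a"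
proof (cases "x \<in> B")
  case True
  have "int_comb {x} (\<lambda>b. if b = x then 1 else 0) = x"
    using x by (simp add: int_comb_def)
  then have "int_rep B x 1 {x} (\<lambda>b. if b = x then 1 else 0)"
    using True x by (simp add: int_rep_def)
  then show ?thesis by blast
next
  case False
  have Bc: "B \<subseteq> carrier G" using B by (simp add: int_indep_def)
  have "\<not> int_indep (insert x B)" using max[of "insert x B"] False by blast
  then obtain F a where F: "finite F" "F \<subseteq> insert x B" and one: "int_comb F a = \<one>"
    and nz: "\<exists>b\<in>F. a b \<noteq> 0"
    using Bc x unfolding int_indep_def by blast
  have xF: "x \<in> F"
    using B F one nz unfolding int_indep_def by blast
  define F' where "F' = F - {x}"
  have F': "finite F'" "F' \<subseteq> B" "x \<notin> F'" "F = insert x F'" "F' \<subseteq> carrier G"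
    using F xF Bc by (auto simp: F'_def)
  have "(\<lambda>b. b [^] a b) \<in> F' \<rightarrow> carrier G" using F' by auto
  then have eq: "x [^] a x \<otimes> int_comb F' a = \<one>"
    using one F' x by (simp add: int_comb_def)
  have "a x \<noteq> 0"
  proof
    assume "a x = 0"
    with eq have "int_comb F' a = \<one>" using int_comb_closed[OF F'(5)] by simp
    then have "\<forall>b\<in>F'. a b = 0" using B F' unfolding int_indep_def by blast
    with nz \<open>a x = 0\<close> F' show False by blast
  qed
  define a' where "a' b = (if b \<in> F' then - a b else 0)" for b
  have "int_comb F' a' \<otimes> int_comb F' a = \<one>"
    using F' int_comb_add[of F' a' a] int_comb_zero[of F' "\<lambda>b. a' b + a b"] by (simp add: a'_def)
  with eq have "x [^] a x = int_comb F' a'"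
    using int_comb_closed[OF F'(5)] x by (metis int_pow_closed right_cancel)
  then have "int_rep B x (a x) F' a'"
    using F' \<open>a x \<noteq> 0\<close> by (simp add: int_rep_def a'_def)
  then show ?thesis by blast
qed

lemma int_rep_unique:
  assumes B: "int_indep B" and x: "x \<in> carrier G"
    and r: "int_rep B x n F a" "int_rep B x m F' a'"
  shows "a b * m = a' b * n"
proof -
  have Bc: "B \<subseteq> carrier G" using B by (simp add: int_indep_def)
  define H where "H = F \<union> F'"
  have H: "finite H" "H \<subseteq> B" "H \<subseteq> carrier G"
    using r Bc by (auto simp: int_rep_def H_def)
  have a: "int_comb H a = x [^] n"
    using r H int_comb_superset[of H F a] by (auto simp: int_rep_def H_def)
  have a': "int_comb H a' = x [^] m"
    using r H int_comb_superset[of H F' a'] by (auto simp: int_rep_def H_def)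
  have "int_comb H (\<lambda>b. a b * m + a' b * (- n)) = (x [^] n) [^] m \<otimes> (x [^] m) [^] (- n)"
    using H int_comb_add[of H "\<lambda>b. a b * m" "\<lambda>b. a' b * (- n)"]
      int_comb_mult[of H a m] int_comb_mult[of H a' "- n"] a a' by simp
  also have "\<dots> = x [^] (n * m + m * (- n))"
    using x by (simp only: int_pow_pow int_pow_mult)
  also have "\<dots> = \<one>" by (simp add: mult.commute)
  finally have "\<forall>b\<in>H. a b * m + a' b * (- n) = 0"
    using B H unfolding int_indep_def by blast
  moreover have "a b = 0 \<and> a' b = 0" if "b \<notin> H"
    using that r by (auto simp: int_rep_def H_def)
  ultimately show ?thesis by (cases "b \<in> H") auto
qed

lemma int_rep_mult:
  assumes B: "B \<subseteq> carrier G" and carr: "x \<in> carrier G" "y \<in> carrier G"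
    and r: "int_rep B x n F a" "int_rep B y m F' a'"
  shows "int_rep B (x \<otimes> y) (n * m) (F \<union> F') (\<lambda>b. a b * m + a' b * n)"
proof -
  define H where "H = F \<union> F'"
  have H: "finite H" "H \<subseteq> carrier G"
    using r B by (auto simp: int_rep_def H_def)
  have a: "int_comb H a = x [^] n"
    using r H int_comb_superset[of H F a] by (auto simp: int_rep_def H_def)
  have a': "int_comb H a' = y [^] m"
    using r H int_comb_superset[of H F' a'] by (auto simp: int_rep_def H_def)
  have "int_comb H (\<lambda>b. a b * m + a' b * n) = (x [^] n) [^] m \<otimes> (y [^] m) [^] n"
    using H int_comb_add[of H "\<lambda>b. a b * m" "\<lambda>b. a' b * n"]
      int_comb_mult[of H a m] int_comb_mult[of H a' n] a a' by simp
  also have "\<dots> = (x \<otimes> y) [^] (n * m)"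
    using carr by (simp add: int_pow_pow int_pow_distrib mult.commute)
  finally show ?thesis using r by (auto simp: int_rep_def H_def)
qed

lemma int_rep_pow:
  assumes B: "B \<subseteq> carrier G" and x: "x \<in> carrier G" and r: "int_rep B x n F a"
  shows "int_rep B (x [^] (k::int)) n F (\<lambda>b. a b * k)"
proof -
  have "finite F" "F \<subseteq> carrier G" using B r by (auto simp: int_rep_def)
  then have "int_comb F (\<lambda>b. a b * k) = (x [^] n) [^] k"
    using r int_comb_mult by (simp add: int_rep_def)
  also have "\<dots> = (x [^] k) [^] n"
    using x by (simp add: int_pow_pow mult.commute)
  finally show ?thesis using r by (simp add: int_rep_def)
qed

text \<open>
  The \<open>\<ell>\<^sup>1\<close> length of the coordinates with respect to \<open>B\<close>.  For independent \<open>B\<close> the choice of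
  representation is immaterial (\<open>basis_length_eq\<close>).
\<close>

definition basis_length :: "'a set \<Rightarrow> 'a \<Rightarrow> real" where
  "basis_length B x =
     (SOME r. \<exists>n F a. int_rep B x n F a \<and> r = (\<Sum>b\<in>F. \<bar>real_of_int (a b)\<bar>) / \<bar>real_of_int n\<bar>)"

lemma basis_length_eq:
  assumes B: "int_indep B" and x: "x \<in> carrier G" and r: "int_rep B x n F a"
    and H: "finite H" "F \<subseteq> H"
  shows "basis_length B x = (\<Sum>b\<in>H. \<bar>real_of_int (a b)\<bar>) / \<bar>real_of_int n\<bar>"
proof -
  have extend: "(\<Sum>b\<in>F'. \<bar>real_of_int (a' b)\<bar>) = (\<Sum>b\<in>H'. \<bar>real_of_int (a' b)\<bar>)"
    if "int_rep B x m F' a'" "finite H'" "F' \<subseteq> H'" for m F' a' H'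
    using that by (intro sum.mono_neutral_left) (auto simp: int_rep_def)
  show ?thesis
    unfolding basis_length_def
  proof (rule some_equality)
    show "\<exists>n' F' a'. int_rep B x n' F' a' \<and> (\<Sum>b\<in>H. \<bar>real_of_int (a b)\<bar>) / \<bar>real_of_int n\<bar>
        = (\<Sum>b\<in>F'. \<bar>real_of_int (a' b)\<bar>) / \<bar>real_of_int n'\<bar>"
      using r extend[OF r H] by metis
  next
    fix s
    assume "\<exists>m F' a'. int_rep B x m F' a'
        \<and> s = (\<Sum>b\<in>F'. \<bar>real_of_int (a' b)\<bar>) / \<bar>real_of_int m\<bar>"
    then obtain m F' a' where r': "int_rep B x m F' a'"
      and s: "s = (\<Sum>b\<in>F'. \<bar>real_of_int (a' b)\<bar>) / \<bar>real_of_int m\<bar>" by blast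
    have nm: "n \<noteq> 0" "m \<noteq> 0" using r r' by (auto simp: int_rep_def)
    have fin: "finite (H \<union> F')" using H r' by (simp add: int_rep_def)
    have coord: "\<bar>real_of_int (a' b)\<bar> / \<bar>real_of_int m\<bar> = \<bar>real_of_int (a b)\<bar> / \<bar>real_of_int n\<bar>" for b
    proof -
      have "real_of_int (a b) * real_of_int m = real_of_int (a' b) * real_of_int n"
        using int_rep_unique[OF B x r r', of b] by (metis of_int_mult)
      then have "\<bar>real_of_int (a b)\<bar> * \<bar>real_of_int m\<bar> = \<bar>real_of_int (a' b)\<bar> * \<bar>real_of_int n\<bar>"
        by (metis abs_mult)
      then show ?thesis using nm by (simp add: field_simps)
    qed
    have "s = (\<Sum>b\<in>H \<union> F'. \<bar>real_of_int (a' b)\<bar> / \<bar>real_of_int m\<bar>)"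
      using extend[OF r' fin] s by (simp add: sum_divide_distrib)
    also have "\<dots> = (\<Sum>b\<in>H \<union> F'. \<bar>real_of_int (a b)\<bar>) / \<bar>real_of_int n\<bar>"
      by (simp add: coord sum_divide_distrib)
    also have "(\<Sum>b\<in>H \<union> F'. \<bar>real_of_int (a b)\<bar>) = (\<Sum>b\<in>H. \<bar>real_of_int (a b)\<bar>)"
      using extend[OF r fin] extend[OF r H] H(2) by (metis le_supI1)
    finally show "s = (\<Sum>b\<in>H. \<bar>real_of_int (a b)\<bar>) / \<bar>real_of_int n\<bar>" .
  qed
qed

lemma torsion_free_int_pow:
  assumes tf: "torsion_free G" and x: "x \<in> carrier G"
    and n: "(n::int) \<noteq> 0" and eq: "x [^] n = \<one>"
  shows "x = \<one>"
proof -
  have "x [^] nat \<bar>n\<bar> = x [^] \<bar>n\<bar>" by (simp add: int_pow_int[symmetric])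
  also have "\<dots> = \<one>" using eq x by (auto simp: abs_if int_pow_neg)
  finally have "x [^] nat \<bar>n\<bar> = \<one>" .
  moreover have "nat \<bar>n\<bar> > 0" using n by simp
  ultimately show ?thesis using tf x unfolding torsion_free_def by blast
qed

lemma basis_length_homogeneous:
  assumes tf: "torsion_free G" and B: "int_indep B"
    and rep: "\<And>x. x \<in> carrier G \<Longrightarrow> \<exists>n F a. int_rep B x n F a"
  shows "homogeneous_length_function G (basis_length B)"
proof -
  have Bc: "B \<subseteq> carrier G" using B by (simp add: int_indep_def)
  have hom: "basis_length B (x [^] k) = real_of_int \<bar>k\<bar> * basis_length B x"
    if x: "x \<in> carrier G" for x and k :: int
  proof -
    obtain n F a where r: "int_rep B x n F a" using rep[OF x] by blast
    then have F: "finite F" by (simp add: int_rep_def)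
    show ?thesis
      using basis_length_eq[OF B x r F]
        basis_length_eq[OF B int_pow_closed[OF x] int_rep_pow[OF Bc x r, of k] F]
      by (simp add: abs_mult sum_distrib_right[symmetric])
  qed
  have nonneg: "0 \<le> basis_length B x" if x: "x \<in> carrier G" for x
  proof -
    obtain n F a where r: "int_rep B x n F a" using rep[OF x] by blast
    then have F: "finite F" by (simp add: int_rep_def)
    show ?thesis using basis_length_eq[OF B x r F] by (simp add: sum_nonneg)
  qed
  have one: "basis_length B \<one> = 0"
    using hom[of \<one> 0] by simp
  have inv: "basis_length B (inv x) = basis_length B x" if x: "x \<in> carrier G" for x
    using hom[OF x, of "- 1"] x by (simp add: int_pow_neg int_pow_1)
  have triangle: "basis_length B (x \<otimes> y) \<le> basis_length B x + basis_length B y"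
    if x: "x \<in> carrier G" and y: "y \<in> carrier G" for x y
  proof -
    obtain n F a where r: "int_rep B x n F a" using rep[OF x] by blast
    obtain m F' a' where r': "int_rep B y m F' a'" using rep[OF y] by blast
    define H where "H = F \<union> F'"
    have H: "finite H" "F \<subseteq> H" "F' \<subseteq> H" and nm: "n \<noteq> 0" "m \<noteq> 0"
      using r r' by (auto simp: int_rep_def H_def)
    have "basis_length B (x \<otimes> y)
        = (\<Sum>b\<in>H. \<bar>real_of_int (a b * m + a' b * n)\<bar>) / \<bar>real_of_int (n * m)\<bar>"
      using basis_length_eq[OF B _ int_rep_mult[OF Bc x y r r'] H(1)] x y by (simp add: H_def)
    also have "\<dots> \<le> (\<Sum>b\<in>H. \<bar>real_of_int (a b)\<bar> * \<bar>real_of_int m\<bar>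
        + \<bar>real_of_int (a' b)\<bar> * \<bar>real_of_int n\<bar>) / \<bar>real_of_int (n * m)\<bar>"
      by (intro divide_right_mono sum_mono)
        (auto simp: abs_mult[symmetric] intro: abs_triangle_ineq)
    also have "\<dots> = (\<Sum>b\<in>H. \<bar>real_of_int (a b)\<bar>) / \<bar>real_of_int n\<bar>
        + (\<Sum>b\<in>H. \<bar>real_of_int (a' b)\<bar>) / \<bar>real_of_int m\<bar>"
      using nm by (simp add: sum.distrib sum_distrib_right[symmetric] abs_mult add_divide_distrib)
    also have "\<dots> = basis_length B x + basis_length B y"
      using basis_length_eq[OF B x r H(1,2)] basis_length_eq[OF B y r' H(1,3)] by simp
    finally show ?thesis .
  qed
  have pos: "0 < basis_length B x" if x: "x \<in> carrier G" and ne: "x \<noteq> \<one>" for x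
  proof (rule ccontr)
    assume "\<not> 0 < basis_length B x"
    then have zero: "basis_length B x = 0" using nonneg[OF x] by simp
    obtain n F a where r: "int_rep B x n F a" using rep[OF x] by blast
    then have F: "finite F" "F \<subseteq> carrier G" and n: "n \<noteq> 0"
      using Bc by (auto simp: int_rep_def)
    have "(\<Sum>b\<in>F. \<bar>real_of_int (a b)\<bar>) = 0"
      using basis_length_eq[OF B x r F(1)] zero n by simp
    then have "\<forall>b\<in>F. a b = 0" using F by (simp add: sum_nonneg_eq_0_iff)
    then have "x [^] n = \<one>" using r F int_comb_zero[of F a] by (simp add: int_rep_def)
    with torsion_free_int_pow[OF tf x n] ne show False by simp
  qed
  show ?thesis
    unfolding homogeneous_length_function_def length_function_def
    using hom nonneg one inv triangle pos by auto
qed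

lemma torsion_free_imp_homogeneous:
  assumes "torsion_free G"
  shows "\<exists>l. homogeneous_length_function G l"
proof -
  obtain B where B: "int_indep B" and max: "\<And>X. int_indep X \<Longrightarrow> B \<subseteq> X \<Longrightarrow> X = B"
    using exists_maximal_int_indep by blast
  have "homogeneous_length_function G (basis_length B)"
    using assms B maximal_int_indep_rep[OF B max] by (rule basis_length_homogeneous)
  then show ?thesis by blast
qed

end

theorem corollary1p4:
  fixes G :: "('a, 'b) monoid_scheme"
  assumes "group G"
  shows "(\<exists>l. homogeneous_length_function G l) \<longleftrightarrow> comm_group G \<and> torsion_free G"
  using group.homogeneous_imp_comm_group[OF assms] group.homogeneous_imp_torsion_free[OF assms]
    comm_group.torsion_free_imp_homogeneous by blast

end
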